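(* Every Ostaszewski space is an uncountable, perfectly normal, hereditarily separable and exponentially separable space.
   Context: All spaces are Hausdorff. "Ostaszewski space" is the well-known notion from set-theoretic topology: as is well known, an Ostaszewski space $X$ has underlying set $\omega_1$, and its topology has the following properties: $X$ is hereditarily separable (every subspace is separable), locally countable (every point has a countable neighborhood), locally compact, and each closed subset of $X$ is either countable or co-countable. A space is perfectly normal if it is normal and each of its closed subsets is a $G_\delta$. Given a family $\mathcal{F}$ of subsets of $X$, a set $A\subset X$ is strongly dense in $\mathcal{F}$ if $A\cap\bigcap\mathcal{G}\neq\emptyset$ whenever $\mathcal{G}\subset\mathcal{F}$ and $\bigcap\mathcal{G}\neq\emptyset$. $X$ is exponentially separable if for every countable family $\mathcal{F}$ of closed subsets of $X$ there is a countable $A\subset X$ that is strongly dense in $\mathcal{F}$. *)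

theory Defs
  imports "HOL-Analysis.Analysis"
begin

unbundle cardinal_syntax

definition countably_compact_space :: "'a topology \<Rightarrow> bool" where
  "countably_compact_space X \<longleftrightarrow>
     (\<forall>\<U>. countable \<U> \<and> (\<forall>U\<in>\<U>. openin X U) \<and> topspace X \<subseteq> \<Union>\<U>
        \<longrightarrow> (\<exists>\<V>. finite \<V> \<and> \<V> \<subseteq> \<U> \<and> topspace X \<subseteq> \<Union>\<V>))"

definition locally_countable_space :: "'a topology \<Rightarrow> bool" where
  "locally_countable_space X \<longleftrightarrow>
     (\<forall>x\<in>topspace X. \<exists>U N. openin X U \<and> x \<in> U \<and> U \<subseteq> N \<and> N \<subseteq> topspace X \<and> countable N)"

(* The cardinal equation says that the underlying set is a copy of omega_1: here cardSuc natLeq is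
   the successor cardinal of the countable infinite one. The order of omega_1 plays no role in
   the topological properties, so X is not tied to one particular copy.

   Countable compactness belongs to the standard notion: Ostaszewski's spaces are countably
   compact. It cannot be dropped here, since under the diamond principle there are locally compact,
   locally countable, hereditarily separable Hausdorff topologies on omega_1, with every closed set
   countable or co-countable, that are not normal. *)
definition ostaszewski_space :: "'a topology \<Rightarrow> bool" where
  "ostaszewski_space X \<longleftrightarrow>
     |topspace X| =o cardSuc natLeq \<and>
     Hausdorff_space X \<and>
     hereditarily separable_space X \<and>
     locally_countable_space X \<and>
     locally_compact_space X \<and>
     countably_compact_space X \<and>
     (\<forall>C. closedin X C \<longrightarrow> countable C \<or> countable (topspace X - C))"

definition perfectly_normal_space :: "'a topology \<Rightarrow> bool" where
  "perfectly_normal_space X \<longleftrightarrow>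
     normal_space X \<and> (\<forall>C. closedin X C \<longrightarrow> gdelta_in X C)"

(* Intersections are taken inside the space, so that the empty subfamily has intersection
   topspace X rather than UNIV. *)
definition strongly_dense_in :: "'a topology \<Rightarrow> 'a set \<Rightarrow> 'a set set \<Rightarrow> bool" where
  "strongly_dense_in X A \<F> \<longleftrightarrow>
     A \<subseteq> topspace X \<and>
     (\<forall>\<G>\<subseteq>\<F>. topspace X \<inter> \<Inter>\<G> \<noteq> {} \<longrightarrow> A \<inter> (topspace X \<inter> \<Inter>\<G>) \<noteq> {})"

definition exponentially_separable_space :: "'a topology \<Rightarrow> bool" where
  "exponentially_separable_space X \<longleftrightarrow>
     (\<forall>\<F>. countable \<F> \<and> (\<forall>C\<in>\<F>. closedin X C)
        \<longrightarrow> (\<exists>A. countable A \<and> strongly_dense_in X A \<F>))"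

end

(* In such a space a closed set is either small (countable) or large (co-countable), and two large
   sets meet. A countable closed set is compact, being Lindelof and countably compact, and of two
   disjoint closed sets one is countable; so regularity gives normality. A co-countable closed set
   is a G_delta because its complement is a countable union of points, and a countable closed set
   because it lies in a countable open set, from which countably many points are removed. For
   exponential separability take the union of the countable members of the family, plus one point
   common to all the co-countable ones. *)
theory Submission
  imports Defs "HOL-Library.Countable_Set_Type"
begin

lemma uncountable_if_card_eq_cardSuc_natLeq:
  assumes "|A| =o cardSuc natLeq"
  shows "uncountable A"
proof
  assume "countable A"
  then have "|A| \<le>o natLeq"
    by (simp add: countable_card_le_natLeq)
  also have "natLeq <o cardSuc natLeq"
    by (rule cardSuc_greater[OF natLeq_Card_order])
  finally show False
    using assms not_ordLess_ordIso by blast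
qed

text \<open>A countable set is Lindelof: one member of the cover for each point already covers it.
  Closedness then allows passing to a countable cover of the whole space.\<close>

lemma countably_compact_space_countable_closedin_imp_compactin:
  assumes X: "countably_compact_space X" and C: "closedin X C" "countable C"
  shows "compactin X C"
  unfolding compactin_def
proof (intro conjI allI impI)
  show sub: "C \<subseteq> topspace X"
    using C(1) by (rule closedin_subset)
  fix \<U> assume \<U>: "(\<forall>U\<in>\<U>. openin X U) \<and> C \<subseteq> \<Union>\<U>"
  then have "\<forall>x\<in>C. \<exists>U\<in>\<U>. x \<in> U"
    by blast
  then obtain f where f: "\<And>x. x \<in> C \<Longrightarrow> f x \<in> \<U> \<and> x \<in> f x"
    by metis
  \<comment> \<open>The complement of \<open>C\<close> is open and takes care of all points outside
    \<open>C\<close>; it need not belong to \<U>, so it is discarded again after a finite subcover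
    is found.\<close>
  let ?\<W> = "insert (topspace X - C) (f ` C)"
  have "countable ?\<W>" "\<forall>U\<in>?\<W>. openin X U" "topspace X \<subseteq> \<Union>?\<W>"
    using C \<U> f by auto
  then obtain \<V> where \<V>: "finite \<V>" "\<V> \<subseteq> ?\<W>" "topspace X \<subseteq> \<Union>\<V>"
    using X unfolding countably_compact_space_def by meson
  have "finite (\<V> - {topspace X - C})"
    using \<V>(1) by simp
  moreover have "\<V> - {topspace X - C} \<subseteq> \<U>"
    using \<V>(2) f by auto
  moreover have "C \<subseteq> \<Union>(\<V> - {topspace X - C})"
  proof
    fix x assume "x \<in> C"
    then obtain V where "V \<in> \<V>" "x \<in> V"
      using \<V>(3) sub by (meson UnionE subsetD)
    with \<open>x \<in> C\<close> show "x \<in> \<Union>(\<V> - {topspace X - C})"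
      by auto
  qed
  ultimately show "\<exists>\<F>. finite \<F> \<and> \<F> \<subseteq> \<U> \<and> C \<subseteq> \<Union>\<F>"
    by blast
qed

lemma t1_space_countable_imp_fsigma_in:
  assumes "t1_space X" "S \<subseteq> topspace X" "countable S"
  shows "fsigma_in X S"
proof -
  have "fsigma_in X (\<Union>x\<in>S. {x})"
    using assms by (intro fsigma_in_Union)
      (auto intro!: closed_imp_fsigma_in simp: t1_space_closedin_singleton)
  then show ?thesis
    by simp
qed

lemma locally_countable_space_countable_subset_open:
  assumes "locally_countable_space X" "C \<subseteq> topspace X" "countable C"
  obtains U where "openin X U" "C \<subseteq> U" "countable U"
proof -
  \<comment> \<open>An open set inside a countable neighborhood is itself countable.\<close>
  have "\<forall>x\<in>C. \<exists>U. openin X U \<and> x \<in> U \<and> countable U"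
    using assms unfolding locally_countable_space_def by (meson countable_subset subsetD)
  then obtain f where f: "\<And>x. x \<in> C \<Longrightarrow> openin X (f x) \<and> x \<in> f x \<and> countable (f x)"
    by metis
  show thesis
  proof
    show "openin X (\<Union>(f ` C))" "C \<subseteq> \<Union>(f ` C)" "countable (\<Union>(f ` C))"
      using f assms(3) by auto
  qed
qed

lemma locally_countable_t1_space_countable_imp_gdelta_in:
  assumes "locally_countable_space X" "t1_space X" "C \<subseteq> topspace X" "countable C"
  shows "gdelta_in X C"
proof -
  obtain U where U: "openin X U" "C \<subseteq> U" "countable U"
    using locally_countable_space_countable_subset_open assms by blast
  have "fsigma_in X (U - C)"
    using U openin_subset[OF U(1)] assms(2)
    by (intro t1_space_countable_imp_fsigma_in) auto
  \<comment> \<open>Removing an F_sigma set from an open set leaves a G_delta set, here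
    \<open>C\<close> itself.\<close>
  then have "gdelta_in X (U - (U - C))"
    using U(1) by (intro gdelta_in_diff open_imp_gdelta_in)
  then show ?thesis
    using U(2) by (simp add: double_diff)
qed

lemma t1_space_cocountable_imp_gdelta_in:
  assumes "t1_space X" "C \<subseteq> topspace X" "countable (topspace X - C)"
  shows "gdelta_in X C"
  using assms by (simp add: gdelta_in_fsigma_in t1_space_countable_imp_fsigma_in)

lemma normal_space_if_closed_compact_or_cocountable:
  assumes "regular_space X" "uncountable (topspace X)"
    and C: "\<And>C. closedin X C \<Longrightarrow> compactin X C \<or> countable (topspace X - C)"
  shows "normal_space X"
  unfolding normal_space_def
proof (intro allI impI)
  fix S T assume ST: "closedin X S \<and> closedin X T \<and> disjnt S T"
  have sep: "\<exists>U V. openin X U \<and> openin X V \<and> S \<subseteq> U \<and> T \<subseteq> V \<and> disjnt U V"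
    if "compactin X S" "closedin X T" "disjnt S T" for S T
    using assms(1) that unfolding regular_space_compact_closed_sets by blast
  \<comment> \<open>The complements of disjoint sets cover the space, so an uncountable space does
    not allow both to be countable.\<close>
  have "\<not> (countable (topspace X - S) \<and> countable (topspace X - T))"
  proof
    assume "countable (topspace X - S) \<and> countable (topspace X - T)"
    then have "countable ((topspace X - S) \<union> (topspace X - T))"
      by simp
    moreover have "(topspace X - S) \<union> (topspace X - T) = topspace X"
      using ST by (auto simp: disjnt_def)
    ultimately show False
      using assms(2) by simp
  qed
  then consider "compactin X S" | "compactin X T"
    using C[of S] C[of T] ST by metis
  then show "\<exists>U V. openin X U \<and> openin X V \<and> S \<subseteq> U \<and> T \<subseteq> V \<and> disjnt U V"
  proof cases
    case 1
    then show ?thesis using sep ST by blast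
  next
    case 2
    then show ?thesis using sep[of T S] ST by (metis disjnt_sym)
  qed
qed

lemma exponentially_separable_space_if_closed_countable_or_cocountable:
  assumes unc: "uncountable (topspace X)"
    and C: "\<And>C. closedin X C \<Longrightarrow> countable C \<or> countable (topspace X - C)"
  shows "exponentially_separable_space X"
  unfolding exponentially_separable_space_def
proof (intro allI impI)
  fix \<F> assume \<F>: "countable \<F> \<and> (\<forall>C\<in>\<F>. closedin X C)"
  define \<S> where "\<S> = {C\<in>\<F>. countable C}"
  \<comment> \<open>By the dichotomy each member outside \<S> misses only countably many points.
    Countably many such members together still cannot exhaust the space, so some \<open>p\<close>
    lies in all of them.\<close>
  have "countable (\<Union>C\<in>\<F> - \<S>. topspace X - C)"
    using \<F> C unfolding \<S>_def by (intro countable_UN) auto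
  then obtain p where p: "p \<in> topspace X" "p \<notin> (\<Union>C\<in>\<F> - \<S>. topspace X - C)"
    using unc by (meson countable_subset subsetI)
  show "\<exists>A. countable A \<and> strongly_dense_in X A \<F>"
  proof (intro exI conjI)
    have "countable \<S>"
      using \<F> by (auto simp: \<S>_def intro: countable_subset[of _ \<F>])
    then have "countable (\<Union>C\<in>\<S>. C)"
      by (rule countable_UN) (simp add: \<S>_def)
    then show "countable (insert p (\<Union>\<S>))"
      by simp
    \<comment> \<open>If \<G> has a countable member, every point of the intersection lies in that
      member and hence in the union of \<S>. Otherwise \<open>p\<close> is a common point, also for
      empty \<G>.\<close>
    have "insert p (\<Union>\<S>) \<inter> (topspace X \<inter> \<Inter>\<G>) \<noteq> {}"
      if "\<G> \<subseteq> \<F>" "topspace X \<inter> \<Inter>\<G> \<noteq> {}" for \<G>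
    proof (cases "\<G> \<inter> \<S> = {}")
      case True
      then have "p \<in> topspace X \<inter> \<Inter>\<G>"
        using that p by blast
      then show ?thesis by blast
    next
      case False
      then show ?thesis using that by blast
    qed
    moreover have "insert p (\<Union>\<S>) \<subseteq> topspace X"
      using p \<F> closedin_subset unfolding \<S>_def by blast
    ultimately show "strongly_dense_in X (insert p (\<Union>\<S>)) \<F>"
      unfolding strongly_dense_in_def by blast
  qed
qed

theorem theorem23:
  fixes X :: "'a topology"
  assumes "ostaszewski_space X"
  shows "uncountable (topspace X) \<and> perfectly_normal_space X \<and>
         hereditarily separable_space X \<and> exponentially_separable_space X"
proof -
  have card: "|topspace X| =o cardSuc natLeq" and haus: "Hausdorff_space X"
    and hsep: "hereditarily separable_space X" and lcount: "locally_countable_space X"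
    and lcomp: "locally_compact_space X" and ccomp: "countably_compact_space X"
    and dich: "\<And>C. closedin X C \<Longrightarrow> countable C \<or> countable (topspace X - C)"
    using assms unfolding ostaszewski_space_def by blast+
  have unc: "uncountable (topspace X)"
    using card by (rule uncountable_if_card_eq_cardSuc_natLeq)
  have t1: "t1_space X"
    using haus by (rule Hausdorff_imp_t1_space)
  have "normal_space X"
    using locally_compact_Hausdorff_imp_regular_space[OF lcomp haus] unc
  proof (rule normal_space_if_closed_compact_or_cocountable)
    \<comment> \<open>Countable compactness enters here, turning the countable case of the dichotomy
      into a compact one.\<close>
    show "compactin X C \<or> countable (topspace X - C)" if "closedin X C" for C
      using dich[OF that] countably_compact_space_countable_closedin_imp_compactin[OF ccomp that]
      by blast
  qed
  moreover have "gdelta_in X C" if "closedin X C" for C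
    using dich[OF that]
      locally_countable_t1_space_countable_imp_gdelta_in[OF lcount t1 closedin_subset[OF that]]
      t1_space_cocountable_imp_gdelta_in[OF t1 closedin_subset[OF that]]
    by metis
  ultimately have "perfectly_normal_space X"
    unfolding perfectly_normal_space_def by blast
  moreover have "exponentially_separable_space X"
    using unc dich by (rule exponentially_separable_space_if_closed_countable_or_cocountable)
  ultimately show ?thesis
    using unc hsep by blast
qed

end
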